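(* Let $m\geq 3$ and $k\geq 4$ be integers, and let $F(m,k)$ be the $(m,k)$-firecracker tree. Then $$hc(F(m,k))=\begin{cases} m^2k^2-6m(k-1)-\frac{k}{2}(m^2-1)+2, & \text{if } m \text{ is odd},\\[4pt] m^2k^2-6m(k-1)-\frac{k}{2}m^2+2, & \text{if } m \text{ is even}.\end{cases}$$
   Context: For a connected graph $G$ of order $n$ (finite, simple), $D(u,v)$ denotes the detour distance between vertices $u,v$, i.e. the length of a longest $u,v$-path in $G$ (for a tree this is the ordinary distance). A hamiltonian coloring of $G$ is a map $c: V(G)\to\{0,1,2,\dots\}$ such that $D(u,v)+|c(u)-c(v)|\geq n-1$ for every two distinct vertices $u,v$. The value $hc(c)$ is the maximum color assigned by $c$, and the hamiltonian chromatic number $hc(G)$ is the minimum of $hc(c)$ over all hamiltonian colorings $c$ of $G$ (note that the color $0$ is allowed). A $k$-star is a tree consisting of $k$ leaves and another vertex joined to all leaves by edges. The $(m,k)$-firecracker tree $F(m,k)$ is the tree obtained by taking $m$ copies of a $(k-1)$-star and identifying a leaf of each of them with a different vertex of a path of length $m-1$ (a path on $m$ vertices); it has $mk$ vertices. *)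

theory Defs
  imports Complex_Main "Graph_Theory.Graph_Theory"
begin

text \<open>Finite simple graphs are the symmetric loop-free digraphs of the locale
  \<^locale>\<open>pair_graph\<close>: an edge is a pair of opposite arcs. A path is an \<open>apath\<close>, that is, the
  list of arcs of a walk without repeated vertices, so its length is its number of edges.\<close>

definition detour_dist :: "'a pair_pre_digraph \<Rightarrow> 'a \<Rightarrow> 'a \<Rightarrow> nat" where
  "detour_dist G u v = Max {length p | p. pre_digraph.apath (with_proj G) u p v}"

definition hamiltonian_coloring :: "'a pair_pre_digraph \<Rightarrow> ('a \<Rightarrow> nat) \<Rightarrow> bool" where
  "hamiltonian_coloring G c \<longleftrightarrow>
     (\<forall>u \<in> pverts G. \<forall>v \<in> pverts G. u \<noteq> v \<longrightarrow>
        int (detour_dist G u v) + \<bar>int (c u) - int (c v)\<bar> \<ge> int (card (pverts G)) - 1)"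

definition max_color :: "'a pair_pre_digraph \<Rightarrow> ('a \<Rightarrow> nat) \<Rightarrow> nat" where
  "max_color G c = Max (c ` pverts G)"

definition hamiltonian_chromatic_number :: "'a pair_pre_digraph \<Rightarrow> nat" where
  "hamiltonian_chromatic_number G = (LEAST h. \<exists>c. hamiltonian_coloring G c \<and> max_color G c = h)"

text \<open>The \<open>i\<close>-th copy of the \<open>(k - 1)\<close>-star has centre \<open>(i, 0)\<close> and leaves \<open>(i, 1)\<close>, \dots,
  \<open>(i, k - 1)\<close>; its leaf \<open>(i, 1)\<close> is the \<open>i\<close>-th vertex of the path.\<close>

definition firecracker :: "nat \<Rightarrow> nat \<Rightarrow> (nat \<times> nat) pair_pre_digraph" where
  "firecracker m k =
     (let E = {((i, 0), (i, j)) | i j. i < m \<and> 1 \<le> j \<and> j < k}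
            \<union> {((i, 1), (Suc i, 1)) | i. Suc i < m}
      in \<lparr> pverts = {..<m} \<times> {..<k}, parcs = E \<union> E\<inverse> \<rparr>)"


text \<open>The maximum and the minimum above are attained for every connected graph.\<close>

lemma detour_dist_attained:
  assumes "pair_graph G" "connected (with_proj G)" "u \<in> pverts G" "v \<in> pverts G"
  shows "finite {length p | p. pre_digraph.apath (with_proj G) u p v}"
    and "\<exists>p. pre_digraph.apath (with_proj G) u p v \<and> length p = detour_dist G u v"
proof -
  interpret pair_graph G by fact
  show fin: "finite {length p | p. pre_digraph.apath (with_proj G) u p v}"
    using apaths_finite[of u v] by simp
  have "u \<rightarrow>\<^sup>*\<^bsub>with_proj G\<^esub> v"
    using symmetric_connected_imp_strongly_connected[OF sym_arcs assms(2)] assms(3,4)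
    by (auto elim: strongly_connectedE)
  then have "{length p | p. pre_digraph.apath (with_proj G) u p v} \<noteq> {}"
    using reachable_apath by auto
  from Max_in[OF fin this]
  show "\<exists>p. pre_digraph.apath (with_proj G) u p v \<and> length p = detour_dist G u v"
    unfolding detour_dist_def by force
qed

lemma hamiltonian_chromatic_number_attained:
  assumes "pair_graph G"
  shows "\<exists>c. hamiltonian_coloring G c \<and> max_color G c = hamiltonian_chromatic_number G"
proof -
  interpret pair_graph G by fact
  obtain f :: "'a \<Rightarrow> nat" where f: "inj_on f (pverts G)"
    using finite_imp_inj_to_nat_seg[OF pair_finite_verts] by blast
  define n where "n = card (pverts G)"
  define c where "c v = n * f v" for v
  have "hamiltonian_coloring G c"
    unfolding hamiltonian_coloring_def n_def[symmetric]
  proof (intro ballI impI)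
    fix u v assume "u \<in> pverts G" "v \<in> pverts G" "u \<noteq> v"
    then have "f u \<noteq> f v" using f by (auto dest: inj_onD)
    then have "1 \<le> \<bar>int (f u) - int (f v)\<bar>" by auto
    then have "int n * 1 \<le> int n * \<bar>int (f u) - int (f v)\<bar>" by (intro mult_left_mono) auto
    also have "\<dots> = \<bar>int (c u) - int (c v)\<bar>"
      by (simp add: c_def abs_mult flip: right_diff_distrib)
    finally show "int n - 1 \<le> int (detour_dist G u v) + \<bar>int (c u) - int (c v)\<bar>" by simp
  qed
  then have "\<exists>h c. hamiltonian_coloring G c \<and> max_color G c = h" by blast
  then show ?thesis unfolding hamiltonian_chromatic_number_def by (rule LeastI_ex)
qed

lemma card_firecracker: "card (pverts (firecracker m k)) = m * k"
  by (simp add: firecracker_def Let_def)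

lemma pair_graph_firecracker:
  assumes "k \<ge> 2"
  shows "pair_graph (firecracker m k)"
proof -
  have sub: "parcs (firecracker m k) \<subseteq> ({..<m} \<times> {..<k}) \<times> ({..<m} \<times> {..<k})"
    using assms by (auto simp: firecracker_def Let_def)
  have verts: "pverts (firecracker m k) = {..<m} \<times> {..<k}"
    by (simp add: firecracker_def Let_def)
  have fin: "finite (parcs (firecracker m k))"
    using sub by (rule finite_subset) simp
  have sym: "symmetric (with_proj (firecracker m k))"
    by (auto simp: symmetric_def arcs_ends_def arc_to_ends_def firecracker_def Let_def intro!: symI)
  show ?thesis
  proof
    show "fst e \<in> pverts (firecracker m k)" "snd e \<in> pverts (firecracker m k)"
      if "e \<in> parcs (firecracker m k)" for e
      using sub that by (auto simp: verts mem_Times_iff)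
    show "fst e \<noteq> snd e" if "e \<in> parcs (firecracker m k)" for e
      using that by (auto simp: firecracker_def Let_def)
  qed (use fin sym verts in auto)
qed

lemma connected_firecracker:
  assumes "m \<ge> 1" "k \<ge> 2"
  shows "connected (with_proj (firecracker m k))"
proof -
  interpret pair_graph "firecracker m k" using pair_graph_firecracker[OF assms(2)] .
  let ?G = "with_proj (firecracker m k)"
  have verts: "pverts (firecracker m k) = {..<m} \<times> {..<k}"
    by (simp add: firecracker_def Let_def)
  have centre: "(i, j) \<rightarrow>\<^sup>*\<^bsub>?G\<^esub> (i, 0)" if "i < m" "j < k" for i j
  proof (cases "j = 0")
    case True
    then show ?thesis using that by (auto simp: verts)
  next
    case False
    then have "((i, j), (i, 0)) \<in> parcs (firecracker m k)"
      using that by (auto simp: firecracker_def Let_def)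
    then show ?thesis by (intro reachable_adjI) simp
  qed
  have path: "(i, 1) \<rightarrow>\<^sup>*\<^bsub>?G\<^esub> (0, 1)" if "i < m" for i
    using that
  proof (induction i)
    case 0
    then show ?case using assms by (auto simp: verts)
  next
    case (Suc i)
    then have "((Suc i, 1), (i, 1)) \<in> parcs (firecracker m k)"
      by (auto simp: firecracker_def Let_def)
    then have "(Suc i, 1) \<rightarrow>\<^sup>*\<^bsub>?G\<^esub> (i, 1)" by (intro reachable_adjI) simp
    with Suc show ?case by (auto intro: reachable_trans)
  qed
  have root: "v \<rightarrow>\<^sup>*\<^bsub>?G\<^esub> (0, 1)" if v: "v \<in> pverts (firecracker m k)" for v
  proof -
    obtain i j where v': "v = (i, j)" "i < m" "j < k" using v by (auto simp: verts)
    have "(i, 0) \<rightarrow>\<^sup>*\<^bsub>?G\<^esub> (i, 1)"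
      using centre[of i 1] v' assms by (auto intro: symmetric_reachable[OF sym_arcs])
    with centre[of i j] path[of i] v' show ?thesis by (auto intro: reachable_trans)
  qed
  have "u \<rightarrow>\<^sup>*\<^bsub>?G\<^esub> v"
    if "u \<in> pverts (firecracker m k)" "v \<in> pverts (firecracker m k)" for u v
    using root[OF that(1)] symmetric_reachable[OF sym_arcs root[OF that(2)]]
    by (rule reachable_trans)
  then show ?thesis
    using assms unfolding connected_def
    by (intro strongly_connectedI) (auto simp: verts lessThan_empty_iff intro: reachable_mk_symmetricI)
qed

end

theory Submission
  imports Defs
begin

text \<open>The weight centre of the firecracker is the middle vertex of the path, or its two middle vertices
  if \<open>m\<close> is even; let \<open>L\<close> be the distance to it and \<open>\<epsilon>\<close> be \<open>0\<close> or \<open>1\<close> accordingly. Then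
  \<open>D u v \<le> L u + L v + \<epsilon>\<close>, so summing the colour gaps of consecutive vertices, ordered by
  colour, bounds the largest colour from below in terms of the sum of \<open>L\<close> and the levels of
  the first and the last vertex. Equality holds for the greedy colouring along an order in which
  consecutive vertices lie on different sides of the centre and whose ends have the least possible
  total level.\<close>

section \<open>Bounds on the detour distance by functions on the vertices\<close>

text \<open>Along any walk \<open>f\<close> changes by at most one per arc, and a longest path is
  such a walk. With signed levels for \<open>f\<close> this yields the lower bounds on distances
  between different sides.\<close>

lemma detour_dist_ge:
  fixes f :: "'a \<Rightarrow> int"
  assumes "pair_graph G" "connected (with_proj G)" "u \<in> pverts G" "v \<in> pverts G"
    and lip: "\<And>x y. (x, y) \<in> parcs G \<Longrightarrow> \<bar>f x - f y\<bar> \<le> 1"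
  shows "\<bar>f u - f v\<bar> \<le> int (detour_dist G u v)"
proof -
  interpret pair_graph G by fact
  obtain p where p: "apath u p v" "length p = detour_dist G u v"
    using detour_dist_attained(2)[OF assms(1-4)] by blast
  have "\<bar>f x - f v\<bar> \<le> int (length q)" if "awalk x q v" for x q
    using that
  proof (induction q arbitrary: x)
    case Nil
    then show ?case by (auto simp: awalk_def)
  next
    case (Cons e q)
    then have "(x, snd e) \<in> parcs G" "awalk (snd e) q v"
      by (auto simp: awalk_Cons_iff)
    with lip[of x "snd e"] Cons.IH[of "snd e"] show ?case by simp
  qed
  with p show ?thesis by (metis apath_def)
qed

text \<open>The indicator function of \<open>u\<close> changes by at most one along arcs and
  separates \<open>u\<close> from \<open>v\<close>.\<close>

lemma detour_dist_pos:
  assumes "pair_graph G" "connected (with_proj G)" "u \<in> pverts G" "v \<in> pverts G" "u \<noteq> v"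
  shows "1 \<le> detour_dist G u v"
  using detour_dist_ge[OF assms(1-4), of "\<lambda>x. if x = u then 1 else 0"] assms(5) by auto

text \<open>A path that has once made a step away from the centre cannot turn back, because every vertex
  has at most one neighbour that is not farther from the centre than itself.\<close>

lemma detour_dist_le:
  fixes L :: "'a \<Rightarrow> nat" and \<epsilon> :: nat
  assumes "pair_graph G" "connected (with_proj G)" "u \<in> pverts G" "v \<in> pverts G"
    and uniq: "\<And>x y z. (y, x) \<in> parcs G \<Longrightarrow> (y, z) \<in> parcs G \<Longrightarrow> L x \<le> L y \<Longrightarrow> L z \<le> L y \<Longrightarrow> x = z"
    and step: "\<And>x y. (x, y) \<in> parcs G \<Longrightarrow> L y \<le> Suc (L x)"
    and flat: "\<And>x y. (x, y) \<in> parcs G \<Longrightarrow> L x = L y \<Longrightarrow> 1 \<le> \<epsilon>"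
  shows "detour_dist G u v \<le> L u + L v + \<epsilon>"
proof -
  interpret pair_graph G by fact
  have symD: "(y, x) \<in> parcs G" if "(x, y) \<in> parcs G" for x y
    using that by (metis arcs_symmetric)
  \<comment> \<open>The arc from \<open>x\<close> to \<open>y\<close> is the last one traversed and
    does not descend. The claim says that every arc of the rest \<open>p\<close> then raises
    \<open>L\<close> by exactly one.\<close>
  have down: "L y + length p = L v"
    if "awalk y p v" "distinct (x # awalk_verts y p)" "(x, y) \<in> parcs G" "L x \<le> L y" for x y p
    using that
  proof (induction p arbitrary: x y)
    case Nil
    then show ?case by (auto simp: awalk_def)
  next
    case (Cons e p)
    then have e: "(y, snd e) \<in> parcs G" "awalk (snd e) p v" "fst e = y"
      by (auto simp: awalk_Cons_iff)
    have "snd e \<in> set (awalk_verts (snd e) p)"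
      using e(2) by (cases p) (auto simp: awalk_Cons_iff)
    then have "snd e \<noteq> x" using Cons.prems(2) by auto
    \<comment> \<open>Otherwise \<open>x\<close> and \<open>snd e\<close> would be two different
      neighbours of \<open>y\<close>, neither farther from the centre than \<open>y\<close>.\<close>
    then have "\<not> L (snd e) \<le> L y"
      using uniq[OF symD[OF Cons.prems(3)] e(1)] Cons.prems(4) by auto
    then have "L (snd e) = Suc (L y)" using step[OF e(1)] by simp
    moreover have "distinct (y # awalk_verts (snd e) p)" using Cons.prems(2) e by simp
    ultimately show ?case using Cons.IH[OF e(2) _ e(1)] by simp
  qed
  have "length p \<le> L x + L v + \<epsilon>" if "apath x p v" for x p
    using that
  proof (induction p arbitrary: x)
    case Nil
    then show ?case by simp
  next
    case (Cons e p)
    then have e: "(x, snd e) \<in> parcs G" "awalk (snd e) p v" "distinct (x # awalk_verts (snd e) p)"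
      by (auto simp: apath_def awalk_Cons_iff)
    show ?case
    proof (cases "L x \<le> L (snd e)")
      \<comment> \<open>From here on the path only ascends; \<open>\<epsilon>\<close> pays for this
        arc if it is flat.\<close>
      case True
      with down[OF e(2,3,1)] step[OF e(1)] flat[OF e(1)] show ?thesis
        by (cases "L x = L (snd e)") auto
    next
      case False
      with Cons.IH[of "snd e"] e show ?thesis by (auto simp: apath_def)
    qed
  qed
  moreover obtain p where "apath u p v" "length p = detour_dist G u v"
    using detour_dist_attained(2)[OF assms(1-4)] by blast
  ultimately show ?thesis by metis
qed

section \<open>Colourings and orders of the vertices\<close>

lemma sum_consecutive:
  fixes f :: "nat \<Rightarrow> int"
  shows "(\<Sum>i<n. f i + f (Suc i)) = 2 * (\<Sum>i<Suc n. f i) - f 0 - f n"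
  by (induction n) auto

lemma sum_nth_distinct:
  assumes "distinct us"
  shows "(\<Sum>i<length us. f (us ! i)) = sum f (set us)"
  using sum.reindex_bij_betw[OF bij_betw_nth[OF assms refl refl], of f] by simp

text \<open>Every vertex occurs in two consecutive pairs, except the two ends, which occur in one.
  Hence the order of the list matters only through its ends.\<close>

lemma sum_consecutive_distinct:
  fixes L :: "'a \<Rightarrow> nat"
  assumes "distinct us" "us \<noteq> []"
  shows "(\<Sum>i<length us - 1. int (L (us ! i)) + int (L (us ! Suc i)))
    = 2 * int (sum L (set us)) - int (L (hd us)) - int (L (last us))"
proof -
  have "(\<Sum>i<length us. int (L (us ! i))) = int (sum L (set us))"
    using sum_nth_distinct[OF assms(1), of "\<lambda>v. int (L v)"] by simp
  moreover have "Suc (length us - 1) = length us" using assms(2) by simp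
  ultimately show ?thesis
    using sum_consecutive[of "\<lambda>i. int (L (us ! i))" "length us - 1"] assms(2)
    by (simp add: hd_conv_nth last_conv_nth)
qed

lemma max_color_ge:
  fixes L :: "'a \<Rightarrow> nat" and \<epsilon> :: nat
  assumes fin: "finite (pverts G)" and card: "card (pverts G) \<ge> 2"
    and col: "hamiltonian_coloring G c"
    and le: "\<And>u v. u \<in> pverts G \<Longrightarrow> v \<in> pverts G \<Longrightarrow> u \<noteq> v \<Longrightarrow> detour_dist G u v \<le> L u + L v + \<epsilon>"
    and ends: "\<And>u v. u \<in> pverts G \<Longrightarrow> v \<in> pverts G \<Longrightarrow> u \<noteq> v \<Longrightarrow> \<delta> \<le> L u + L v"
  shows "(int (card (pverts G)) - 1) * (int (card (pverts G)) - 1 - int \<epsilon>)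
    - 2 * int (sum L (pverts G)) + int \<delta> \<le> int (max_color G c)"
proof -
  obtain vs where vs: "set vs = pverts G" "distinct vs" using finite_distinct_list[OF fin] by blast
  \<comment> \<open>Sorting by colour turns the absolute colour differences of neighbours into
    differences that telescope.\<close>
  define us where "us = sort_key c vs"
  have us: "set us = pverts G" "distinct us" "sorted (map c us)"
    using vs by (auto simp: us_def)
  define n where "n = card (pverts G)"
  have len: "length us = n" using us distinct_card n_def by metis
  have n2: "n \<ge> 2" using card n_def by simp
  then have ne: "us \<noteq> []" using len by auto
  have gap: "int n - 1 - int \<epsilon> - (int (L (us ! i)) + int (L (us ! Suc i)))
      \<le> int (c (us ! Suc i)) - int (c (us ! i))" if "i < n - 1" for i
  proof -
    have i: "i < length us" "Suc i < length us" using that len by auto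
    then have in_V: "us ! i \<in> pverts G" "us ! Suc i \<in> pverts G" "us ! i \<noteq> us ! Suc i"
      using us nth_mem nth_eq_iff_index_eq[OF us(2)] by (blast, blast, auto)
    have "c (us ! i) \<le> c (us ! Suc i)"
      using sorted_nth_mono[OF us(3), of i "Suc i"] i by simp
    then have "int n - 1 \<le> int (detour_dist G (us ! i) (us ! Suc i))
        + (int (c (us ! Suc i)) - int (c (us ! i)))"
      using col in_V unfolding hamiltonian_coloring_def n_def by force
    with le[OF in_V] show ?thesis by linarith
  qed
  have "int \<delta> \<le> int (L (hd us)) + int (L (last us))"
  proof -
    have "hd us \<noteq> last us"
      using us(2) n2 len ne nth_eq_iff_index_eq[OF us(2), of 0 "n - 1"]
      by (simp add: hd_conv_nth last_conv_nth)
    then show ?thesis using ends[of "hd us" "last us"] ne us(1) by (metis hd_in_set last_in_set of_nat_add of_nat_mono)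
  qed
  then have "(int n - 1) * (int n - 1 - int \<epsilon>) - 2 * int (sum L (pverts G)) + int \<delta>
      \<le> (int n - 1) * (int n - 1 - int \<epsilon>) - (\<Sum>i<n - 1. int (L (us ! i)) + int (L (us ! Suc i)))"
    using sum_consecutive_distinct[OF us(2) ne, of L] us(1) len by simp
  also have "\<dots> = (\<Sum>i<n - 1. int n - 1 - int \<epsilon> - (int (L (us ! i)) + int (L (us ! Suc i))))"
    using n2 by (simp add: sum_subtractf of_nat_diff)
  also have "\<dots> \<le> (\<Sum>i<n - 1. int (c (us ! Suc i)) - int (c (us ! i)))"
    using gap by (intro sum_mono) auto
  also have "\<dots> = int (c (us ! (n - 1))) - int (c (us ! 0))"
    by (rule sum_lessThan_telescope)
  \<comment> \<open>The smallest colour is estimated by 0.\<close>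
  also have "\<dots> \<le> int (c (us ! (n - 1)))" by simp
  also have "\<dots> \<le> int (max_color G c)"
    unfolding max_color_def using fin us(1) len n2 nth_mem[of "n - 1" us] by (auto intro!: Max_ge)
  finally show ?thesis unfolding n_def .
qed

text \<open>If \<open>2 * s \<le> n\<close>, two consecutive colour gaps already add up to \<open>n - 2\<close>,
  so only consecutive vertices impose a condition.\<close>

lemma hamiltonian_coloring_of_list:
  fixes L :: "'a \<Rightarrow> nat" and \<epsilon> s :: nat and side :: "'a \<Rightarrow> 'b"
  assumes G: "pair_graph G" "connected (with_proj G)"
    and us: "distinct us" "set us = pverts G" "us \<noteq> []"
    and alt: "successively (\<lambda>u v. side u \<noteq> side v) us"
    and ge: "\<And>u v. u \<in> pverts G \<Longrightarrow> v \<in> pverts G \<Longrightarrow> side u \<noteq> side v \<Longrightarrow> L u + L v + \<epsilon> \<le> detour_dist G u v"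
    and le: "\<And>u v. u \<in> pverts G \<Longrightarrow> v \<in> pverts G \<Longrightarrow> L u + L v + \<epsilon> \<le> s"
    and s: "1 \<le> s" "2 * s \<le> card (pverts G)"
  shows "\<exists>c. hamiltonian_coloring G c \<and> int (max_color G c) =
    (int (card (pverts G)) - 1) * (int (card (pverts G)) - 1 - int \<epsilon>)
    - 2 * int (sum L (pverts G)) + int (L (hd us)) + int (L (last us))"
proof -
  define n where "n = card (pverts G)"
  have len: "length us = n" using us distinct_card n_def by metis
  have n2: "n \<ge> 2" using s n_def by simp
  \<comment> \<open>The smallest gap that the condition on two consecutive vertices permits. The
    subtraction does not truncate, since \<open>1 \<le> s\<close> and \<open>2 * s \<le> n\<close>
    give \<open>s \<le> n - 1\<close>.\<close>
  define g where "g i = n - 1 - (L (us ! i) + L (us ! Suc i) + \<epsilon>)" for i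
  have mem: "us ! i \<in> pverts G" if "i < n" for i using that len us(2) nth_mem by blast
  have g_int: "int (g i) = int n - 1 - int \<epsilon> - (int (L (us ! i)) + int (L (us ! Suc i)))"
    and g_ge: "int n - 1 - int s \<le> int (g i)" if "Suc i < n" for i
    using le[OF mem mem, of i "Suc i"] s that unfolding g_def n_def by linarith+
  define t where "t i = (\<Sum>j<i. g j)" for i
  define idx where "idx v = (THE i. i < n \<and> us ! i = v)" for v
  have idx: "idx (us ! i) = i" if "i < n" for i
    unfolding idx_def using that len nth_eq_iff_index_eq[OF us(1)] by (intro the_equality) auto
  define c where "c v = t (idx v)" for v
  have c_nth: "c (us ! i) = t i" if "i < n" for i using idx[OF that] by (simp add: c_def)
  have t_mono: "t i \<le> t j" if "i \<le> j" for i j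
    unfolding t_def using that by (intro sum_mono2) auto
  \<comment> \<open>Both orders of the two vertices appear because the colouring condition ranges
    over ordered pairs.\<close>
  have pair: "int n - 1 \<le> int (detour_dist G (us ! i) (us ! j)) + (int (t j) - int (t i))
      \<and> int n - 1 \<le> int (detour_dist G (us ! j) (us ! i)) + (int (t j) - int (t i))"
    if ij: "i < j" "j < n" for i j
  proof (cases "j = Suc i")
    case True
    have "side (us ! i) \<noteq> side (us ! j)"
      using alt ij len True by (auto simp: successively_conv_nth)
    then have "L (us ! i) + L (us ! j) + \<epsilon> \<le> detour_dist G (us ! i) (us ! j)"
      "L (us ! j) + L (us ! i) + \<epsilon> \<le> detour_dist G (us ! j) (us ! i)"
      using ge mem ij by auto
    moreover have "int (t j) = int (t i) + int (g i)" using True by (simp add: t_def)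
    ultimately show ?thesis using g_int[of i] ij True by simp
  next
    case False
    then have "t (Suc (Suc i)) \<le> t j" using ij by (intro t_mono) simp
    moreover have "int (t (Suc (Suc i))) = int (t i) + int (g i) + int (g (Suc i))"
      by (simp add: t_def)
    moreover have "int n - 1 - int s \<le> int (g i)" "int n - 1 - int s \<le> int (g (Suc i))"
      using g_ge ij False by auto
    moreover have "us ! i \<noteq> us ! j" using ij len nth_eq_iff_index_eq[OF us(1)] by auto
    \<comment> \<open>Two gaps give at least \<open>2 * (n - 1 - s)\<close>, hence
      \<open>n - 2\<close>; the distance of distinct vertices supplies the missing one.\<close>
    then have "1 \<le> detour_dist G (us ! i) (us ! j)" "1 \<le> detour_dist G (us ! j) (us ! i)"
      using detour_dist_pos[OF G] mem ij by auto
    ultimately show ?thesis using s(2) unfolding n_def[symmetric] by linarith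
  qed
  have "hamiltonian_coloring G c"
    unfolding hamiltonian_coloring_def n_def[symmetric]
  proof (intro ballI impI)
    fix u v assume uv: "u \<in> pverts G" "v \<in> pverts G" "u \<noteq> v"
    then obtain i j where "i < n" "u = us ! i" "j < n" "v = us ! j"
      using us(2) len by (metis in_set_conv_nth)
    with uv(3) pair[of i j] pair[of j i] show "int n - 1 \<le> int (detour_dist G u v) + \<bar>int (c u) - int (c v)\<bar>"
      by (cases i j rule: linorder_cases) (auto simp: c_nth)
  qed
  moreover have "max_color G c = t (n - 1)"
    unfolding max_color_def
  proof (rule Max_eqI)
    show "finite (c ` pverts G)" unfolding us(2)[symmetric] by simp
    show "y \<le> t (n - 1)" if "y \<in> c ` pverts G" for y
    proof -
      from that obtain v where v: "y = c v" "v \<in> pverts G" by (rule imageE)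
      from v(2) obtain i where "i < n" "us ! i = v"
        unfolding us(2)[symmetric] in_set_conv_nth len by blast
      then show ?thesis using v(1) c_nth[of i] t_mono[of i "n - 1"] by simp
    qed
    show "t (n - 1) \<in> c ` pverts G"
      using imageI[OF mem[of "n - 1"], of c] c_nth[of "n - 1"] n2 by simp
  qed
  moreover have "int (t (n - 1)) = (\<Sum>i<n - 1. int n - 1 - int \<epsilon> - (int (L (us ! i)) + int (L (us ! Suc i))))"
    unfolding t_def of_nat_sum by (intro sum.cong) (auto simp: g_int)
  moreover have "\<dots> = (int n - 1) * (int n - 1 - int \<epsilon>)
      - (\<Sum>i<n - 1. int (L (us ! i)) + int (L (us ! Suc i)))"
    using n2 by (simp add: sum_subtractf of_nat_diff)
  ultimately show ?thesis
    using sum_consecutive_distinct[OF us(1,3), of L] us(2) len unfolding n_def by (intro exI[of _ c]) simp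
qed

section \<open>Interleaving lists\<close>

text \<open>\<open>xs\<close> and \<open>ys\<close> will list the stars left and right of the
  centre, \<open>zs\<close> the middle star, which exists only for odd \<open>m\<close>. If
  \<open>xs\<close> and \<open>ys\<close> have equal length and \<open>zs\<close> is no longer, the
  last equation is reached only with all three lists empty, so no element is lost.\<close>

fun weave :: "'a list \<Rightarrow> 'a list \<Rightarrow> 'a list \<Rightarrow> 'a list" where
  "weave (z # zs) (x # xs) (y # ys) = z # x # y # weave zs xs ys"
| "weave [] (x # xs) (y # ys) = x # y # weave [] xs ys"
| "weave zs xs ys = []"

lemma mset_weave:
  assumes "length xs = length ys" "length zs \<le> length xs"
  shows "mset (weave zs xs ys) = mset zs + mset xs + mset ys"
  using assms by (induction zs xs ys rule: weave.induct) auto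

lemma weave_eq_Nil:
  assumes "length xs = length ys" "length zs \<le> length xs"
  shows "weave zs xs ys = [] \<longleftrightarrow> ys = []"
  using assms by (cases "(zs, xs, ys)" rule: weave.cases) auto

lemma hd_weave:
  assumes "length xs = length ys" "length zs \<le> length xs" "xs \<noteq> []"
  shows "hd (weave zs xs ys) = (if zs = [] then hd xs else hd zs)"
  using assms by (cases "(zs, xs, ys)" rule: weave.cases) auto

lemma last_weave:
  assumes "length xs = length ys" "length zs \<le> length xs" "ys \<noteq> []"
  shows "last (weave zs xs ys) = last ys"
  using assms by (induction zs xs ys rule: weave.induct) (auto simp: weave_eq_Nil)

text \<open>An element of \<open>ys\<close> is followed by one of \<open>zs\<close> as long as there
  are any, and by one of \<open>xs\<close> afterwards. This is why \<open>R\<close> is required in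
  both directions between \<open>xs\<close> and \<open>ys\<close>, but only in one direction for
  pairs with \<open>zs\<close>.\<close>

lemma successively_weave:
  assumes "length xs = length ys" "length zs \<le> length xs"
    and "\<And>x y. x \<in> set xs \<Longrightarrow> y \<in> set ys \<Longrightarrow> R x y \<and> R y x"
    and "\<And>x z. x \<in> set xs \<Longrightarrow> z \<in> set zs \<Longrightarrow> R z x"
    and "\<And>y z. y \<in> set ys \<Longrightarrow> z \<in> set zs \<Longrightarrow> R y z"
  shows "successively R (weave zs xs ys)"
  using assms
proof (induction zs xs ys rule: weave.induct)
  case (1 z zs x xs y ys)
  have "hd (weave zs xs ys) \<in> set xs \<union> set zs" if "xs \<noteq> []"
    using hd_weave[of xs ys zs] 1 that by auto
  moreover have "weave zs xs ys = [] \<longleftrightarrow> xs = []" using weave_eq_Nil[of xs ys zs] 1 by auto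
  moreover have "successively R (weave zs xs ys)" using 1 by auto
  ultimately show ?case using 1 by (auto simp: successively_Cons)
next
  case (2 x xs y ys)
  have "hd (weave [] xs ys) \<in> set xs" if "xs \<noteq> []"
    using hd_weave[of xs ys "[]"] 2 that by auto
  moreover have "weave [] xs ys = [] \<longleftrightarrow> xs = []" using weave_eq_Nil[of xs ys "[]"] 2 by auto
  moreover have "successively R (weave [] xs ys)" using 2 by auto
  ultimately show ?case using 2 by (auto simp: successively_Cons)
qed auto

lemma ex_distinct_list_hd:
  assumes "finite A" "a \<in> A"
  shows "\<exists>xs. set xs = A \<and> distinct xs \<and> xs \<noteq> [] \<and> hd xs = a"
proof -
  obtain xs where "set xs = A - {a}" "distinct xs"
    using finite_distinct_list[of "A - {a}"] assms by auto
  then show ?thesis using assms by (intro exI[of _ "a # xs"]) auto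
qed

section \<open>Arcs, levels and sides in the firecracker\<close>

lemma parcs_firecracker_iff:
  assumes "k \<ge> 2"
  shows "((i, j), (i', j')) \<in> parcs (firecracker m k) \<longleftrightarrow>
    i < m \<and> i' < m \<and> j < k \<and> j' < k \<and>
    (i = i' \<and> (j = 0 \<and> j' \<noteq> 0 \<or> j \<noteq> 0 \<and> j' = 0) \<or> j = 1 \<and> j' = 1 \<and> (i' = Suc i \<or> i = Suc i'))"
  using assms by (auto simp: firecracker_def Let_def)

lemma pverts_firecracker: "pverts (firecracker m k) = {..<m} \<times> {..<k}"
  by (simp add: firecracker_def Let_def)

text \<open>The path has its centre at position \<open>h\<close> if \<open>\<epsilon> = 0\<close>, and at \<open>h - 1\<close> and \<open>h\<close> if \<open>\<epsilon> = 1\<close>.\<close>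

definition firecracker_level :: "nat \<Rightarrow> nat \<Rightarrow> nat \<times> nat \<Rightarrow> nat" where
  "firecracker_level h \<epsilon> = (\<lambda>(i, j).
     (if i < h then h - \<epsilon> - i else i - h) + (if j = 0 then 1 else if j = 1 then 0 else 2))"

text \<open>Both parities are treated at once: \<open>\<epsilon> = 0\<close> stands for odd
  \<open>m\<close>, \<open>\<epsilon> = 1\<close> for even \<open>m\<close>, and \<open>h\<close> is
  half of \<open>m\<close>, rounded down.\<close>

locale firecracker_levels =
  fixes h \<epsilon> m k :: nat
  assumes h: "1 \<le> h" and eps: "\<epsilon> \<le> 1" and m: "m + \<epsilon> = 2 * h + 1" and m3: "3 \<le> m" and k: "4 \<le> k"
begin

abbreviation "F \<equiv> firecracker m k"

abbreviation "level \<equiv> firecracker_level h \<epsilon>"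

text \<open>For odd \<open>m\<close> the middle star forms a side of its own, with value 1. For even
  \<open>m\<close> the bounds \<open>h\<close> and \<open>m - h\<close> coincide and the value 1
  does not occur.\<close>

definition side :: "nat \<times> nat \<Rightarrow> nat" where
  "side = (\<lambda>(i, j). if i < h then 0 else if m - h \<le> i then 2 else 1)"

lemma cases_eps:
  obtains "\<epsilon> = 0" "m = 2 * h + 1" | "\<epsilon> = 1" "m = 2 * h"
  using eps m by (cases "\<epsilon> = 0") auto

lemma F: "pair_graph F" "connected (with_proj F)"
  using pair_graph_firecracker[of k m] connected_firecracker[of m k] k m3 by auto

lemmas arcs = parcs_firecracker_iff[OF order.trans[OF _ k], simplified]

lemma level_step:
  assumes "(x, y) \<in> parcs F"
  shows "level y \<le> Suc (level x)" and "level x = level y \<Longrightarrow> 1 \<le> \<epsilon>"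
proof -
  show "level y \<le> Suc (level x)"
    using assms by (cases x; cases y; cases rule: cases_eps)
      (auto simp: arcs firecracker_level_def split: if_splits)
  show "1 \<le> \<epsilon>" if "level x = level y"
    using assms that by (cases x; cases y; cases rule: cases_eps)
      (auto simp: arcs firecracker_level_def split: if_splits)
qed

text \<open>Only a path arc at the centre crosses such a cut: it joins levels 0 and 1 for odd
  \<open>m\<close>, and two vertices of level 0 for even \<open>m\<close>. So signed levels, shifted
  by \<open>\<epsilon>\<close> on one side, change by exactly one across the cut.\<close>

lemma level_cross:
  assumes "(x, y) \<in> parcs F" and "(fst x < h) \<noteq> (fst y < h) \<or> (fst x < m - h) \<noteq> (fst y < m - h)"
  shows "level x + level y + \<epsilon> = 1"
  using assms h by (cases x; cases y; cases rule: cases_eps)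
    (auto simp: arcs firecracker_level_def split: if_splits)

text \<open>The only such neighbour is the next vertex towards the centre or, at a middle vertex for
  even \<open>m\<close>, the other middle vertex.\<close>

lemma level_uniq:
  assumes "(y, x) \<in> parcs F" "(y, z) \<in> parcs F" "level x \<le> level y" "level z \<le> level y"
  shows "x = z"
  using assms by (cases x; cases y; cases z; cases rule: cases_eps)
    (auto simp: arcs firecracker_level_def split: if_splits)

lemma detour_le:
  assumes "u \<in> pverts F" "v \<in> pverts F"
  shows "detour_dist F u v \<le> level u + level v + \<epsilon>"
  by (rule detour_dist_le[OF F assms]) (fact level_uniq level_step)+

lemma detour_ge:
  assumes "u \<in> pverts F" "v \<in> pverts F" "side u \<noteq> side v"
  shows "level u + level v + \<epsilon> \<le> detour_dist F u v"
proof -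
  \<comment> \<open>Signed levels. Two cuts are needed because for odd \<open>m\<close> the middle star may lie on either side.\<close>
  define f where "f n x = (if fst x < n then - int (level x) else int (level x) + int \<epsilon>)"
    for n :: nat and x :: "nat \<times> nat"
  have "\<bar>f n u - f n v\<bar> \<le> int (detour_dist F u v)" if "n = h \<or> n = m - h" for n
  proof (rule detour_dist_ge[OF F assms(1,2)])
    fix x y assume xy: "(x, y) \<in> parcs F"
    then have "(y, x) \<in> parcs F" by (cases x; cases y) (auto simp: arcs)
    moreover have "(fst x < n) \<noteq> (fst y < n) \<Longrightarrow> level x + level y + \<epsilon> = 1"
      using level_cross[OF xy] that by blast
    ultimately show "\<bar>f n x - f n y\<bar> \<le> 1"
      using level_step(1)[OF xy] level_step(1)[of y x] by (auto simp: f_def)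
  qed
  from this[of h] this[of "m - h"]
  have "\<bar>f h u - f h v\<bar> \<le> int (detour_dist F u v)" "\<bar>f (m - h) u - f (m - h) v\<bar> \<le> int (detour_dist F u v)"
    by auto
  moreover have "(fst u < h) \<noteq> (fst v < h) \<or> (fst u < m - h) \<noteq> (fst v < m - h)"
    using assms(3) by (auto simp: side_def split: prod.splits if_splits)
  ultimately show ?thesis by (auto simp: f_def split: if_splits)
qed

lemma level_le:
  assumes "u \<in> pverts F" "v \<in> pverts F"
  shows "level u + level v + \<epsilon> \<le> m + 3"
proof -
  \<comment> \<open>The extreme case is a leaf of an outermost star, where equality holds.\<close>
  have "2 * level w + \<epsilon> \<le> m + 3" if "w \<in> pverts F" for w
    using that by (cases w; cases rule: cases_eps) (auto simp: pverts_firecracker firecracker_level_def)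
  from this[OF assms(1)] this[OF assms(2)] show ?thesis by linarith
qed

text \<open>For odd \<open>m\<close> the centre is the only vertex of level 0. For even
  \<open>m\<close> the two middle vertices both have level 0, and the bound is 0.\<close>

lemma level_ends:
  assumes "u \<in> pverts F" "v \<in> pverts F" "u \<noteq> v"
  shows "1 - \<epsilon> \<le> level u + level v"
  using assms by (cases u; cases v; cases rule: cases_eps)
    (auto simp: pverts_firecracker firecracker_level_def split: if_splits)

text \<open>A level is the distance \<open>a i\<close> along the path plus the depth
  \<open>b j\<close> within the star, so the sum splits. The depths in one star add up to
  \<open>2 * k - 3\<close>; the term \<open>3 * m\<close> stands on the left to avoid
  subtraction.\<close>

lemma sum_level: "sum level (pverts F) + 3 * m = h * (h + 1 - 2 * \<epsilon>) * k + 2 * m * k"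
proof -
  define a where "a i = (if i < h then h - \<epsilon> - i else i - h)" for i
  define b :: "nat \<Rightarrow> nat" where "b j = (if j = 0 then 1 else if j = 1 then 0 else 2)" for j
  have "sum level (pverts F) = (\<Sum>i<m. \<Sum>j<k. a i + b j)"
    unfolding pverts_firecracker firecracker_level_def a_def b_def by (simp add: sum.cartesian_product)
  also have "\<dots> = k * (\<Sum>i<m. a i) + m * (\<Sum>j<k. b j)"
    by (simp add: sum.distrib sum_distrib_left mult.commute)
  finally have sum_eq: "sum level (pverts F) = k * (\<Sum>i<m. a i) + m * (\<Sum>j<k. b j)" .
  have "(\<Sum>j<2 + n. b j) = 2 * n + 1" for n by (induction n) (auto simp: b_def eval_nat_numeral)
  moreover have "2 + (k - 2) = k" using k by simp
  ultimately have "(\<Sum>j<k. b j) = 2 * (k - 2) + 1" by metis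
  then have b: "(\<Sum>j<k. b j) + 3 = 2 * k" using k by simp
  \<comment> \<open>From position \<open>h\<close> on, the distances are 0, 1, 2 and so on; those
    before \<open>h\<close> are the same kind of progression read backwards.\<close>
  have split: "(\<Sum>i<h + n. a i) = (\<Sum>i<h. a i) + \<Sum>{..<n}" for n
    by (induction n) (auto simp: a_def)
  have gauss: "2 * \<Sum>{..<n} + n = n * n" for n :: nat by (induction n) auto
  have rev: "(\<Sum>i<h. h - Suc i) = \<Sum>{..<h}" by (rule sum.nat_diff_reindex)
  have a: "(\<Sum>i<m. a i) = h * (h + 1 - 2 * \<epsilon>)"
  proof (cases rule: cases_eps)
    case 1
    have "(\<Sum>i<h. a i) = (\<Sum>i<h. (h - Suc i) + 1)"
      using 1 by (intro sum.cong) (auto simp: a_def)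
    also have "\<dots> = \<Sum>{..<h} + h" using rev by (simp only: sum.distrib) simp
    finally show ?thesis using split[of "Suc h"] gauss[of h] 1 by (simp add: mult_2)
  next
    case 2
    have "(\<Sum>i<h. a i) = \<Sum>{..<h}"
      using 2 rev by (simp add: a_def)
    then show ?thesis using split[of h] gauss[of h] 2 h
      by (simp add: mult_2 diff_mult_distrib2)
  qed
  have "m * (\<Sum>j<k. b j) + 3 * m = 2 * m * k"
    using arg_cong[OF b, of "\<lambda>x. m * x"] by (simp add: algebra_simps)
  then show ?thesis using sum_eq a by simp
qed

section \<open>An order of the vertices with optimal ends\<close>

lemma ex_list:
  "\<exists>us. distinct us \<and> set us = pverts F \<and> us \<noteq> [] \<and> successively (\<lambda>u v. side u \<noteq> side v) us \<and>
    level (hd us) + level (last us) = 1 - \<epsilon>"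
proof -
  define A where "A = {..<h} \<times> {..<k}"
  define B where "B = {m - h..<m} \<times> {..<k}"
  define C where "C = {h..<m - h} \<times> {..<k}"
  have hm: "h \<le> m - h" "h \<le> m" "m - h \<le> m" using m eps h by auto
  \<comment> \<open>The prescribed vertices are the middle of the path and its neighbours. For odd
    \<open>m\<close> the order runs from \<open>(h, 1)\<close> of level 0 to
    \<open>(m - h, 1)\<close> of level 1, for even \<open>m\<close> from one middle vertex to the
    other.\<close>
  obtain xs where xs: "set xs = A" "distinct xs" "xs \<noteq> []" "hd xs = (h - 1, 1)"
    using ex_distinct_list_hd[of A "(h - 1, 1)"] h k by (auto simp: A_def)
  obtain ys' where ys': "set ys' = B" "distinct ys'" "ys' \<noteq> []" "hd ys' = (m - h, 1)"
    using ex_distinct_list_hd[of B "(m - h, 1)"] h k hm by (auto simp: B_def)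
  define ys where "ys = rev ys'"
  have ys: "set ys = B" "distinct ys" "ys \<noteq> []" "last ys = (m - h, 1)"
    using ys' by (auto simp: ys_def last_rev)
  obtain zs where zs: "set zs = C" "distinct zs" "\<epsilon> = 0 \<Longrightarrow> zs \<noteq> [] \<and> hd zs = (h, 1)"
  proof (cases rule: cases_eps)
    case 1
    then show ?thesis using that ex_distinct_list_hd[of C "(h, 1)"] k by (auto simp: C_def)
  next
    case 2
    then show ?thesis using that[of "[]"] by (auto simp: C_def)
  qed
  have len: "length xs = h * k" "length ys = h * k" "length zs = (m - h - h) * k"
    using distinct_card[OF xs(2)] distinct_card[OF ys(2)] distinct_card[OF zs(2)] xs(1) ys(1) zs(1) hm
    by (auto simp: A_def B_def C_def)
  \<comment> \<open>The left side is nonempty and there is at most one middle star.\<close>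
  have "m - h - h \<le> h" using m h by linarith
  then have len': "length xs = length ys" "length zs \<le> length xs" using len by auto
  define us where "us = weave zs xs ys"
  have mset: "mset us = mset zs + mset xs + mset ys"
    unfolding us_def using len' by (rule mset_weave)
  have "set us = A \<union> B \<union> C" using arg_cong[OF mset, of set_mset] xs(1) ys(1) zs(1) by auto
  moreover have "{..<m} = {..<h} \<union> {m - h..<m} \<union> {h..<m - h}" using hm by auto
  ultimately have "set us = pverts F" unfolding pverts_firecracker A_def B_def C_def by auto
  moreover have "distinct us"
  proof -
    have "distinct (zs @ xs @ ys)" using xs ys zs hm by (auto simp: A_def B_def C_def)
    then show ?thesis using mset mset_eq_imp_distinct_iff[of us "zs @ xs @ ys"] by simp
  qed
  moreover have "us \<noteq> []" using weave_eq_Nil[OF len'] ys(3) by (simp add: us_def)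
  moreover have "successively (\<lambda>u v. side u \<noteq> side v) us"
    unfolding us_def using hm
    by (intro successively_weave[OF len']) (auto simp: xs(1) ys(1) zs(1) A_def B_def C_def side_def)
  moreover have "level (hd us) + level (last us) = 1 - \<epsilon>"
    unfolding us_def hd_weave[OF len' xs(3)] last_weave[OF len' ys(3)] ys(4)
  proof (cases rule: cases_eps)
    case 1
    then show "level (if zs = [] then hd xs else hd zs) + level (m - h, 1) = 1 - \<epsilon>"
      using zs(3) by (simp add: firecracker_level_def)
  next
    case 2
    then have "zs = []" using zs(1) by (simp add: C_def)
    then show "level (if zs = [] then hd xs else hd zs) + level (m - h, 1) = 1 - \<epsilon>"
      using 2 xs(4) h by (simp add: firecracker_level_def)
  qed
  ultimately show ?thesis by blast
qed

section \<open>The hamiltonian chromatic number\<close>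

lemma hamiltonian_chromatic_number_eq:
  "int (hamiltonian_chromatic_number F) =
    (int (m * k) - 1) * (int (m * k) - 1 - int \<epsilon>) - 2 * int (sum level (pverts F)) + int (1 - \<epsilon>)"
    (is "_ = ?N")
proof (rule antisym)
  have card: "card (pverts F) = m * k" by (rule card_firecracker)
  \<comment> \<open>Here \<open>3 \<le> m\<close> and \<open>4 \<le> k\<close> ensure that only
    consecutive vertices constrain the colouring.\<close>
  have "2 * (m + 3) \<le> m * 4" using m3 by simp
  also have "\<dots> \<le> m * k" using k by simp
  finally have mk: "2 * (m + 3) \<le> card (pverts F)" unfolding card .
  have big: "2 \<le> card (pverts F)" by (rule order.trans[OF _ mk]) simp
  obtain us where us: "distinct us" "set us = pverts F" "us \<noteq> []"
      "successively (\<lambda>u v. side u \<noteq> side v) us" "level (hd us) + level (last us) = 1 - \<epsilon>"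
    using ex_list by blast
  have "\<exists>c. hamiltonian_coloring F c \<and> int (max_color F c) =
    (int (card (pverts F)) - 1) * (int (card (pverts F)) - 1 - int \<epsilon>)
    - 2 * int (sum level (pverts F)) + int (level (hd us)) + int (level (last us))"
    by (rule hamiltonian_coloring_of_list[OF F us(1-4), where s = "m + 3"])
      (fact detour_ge level_le mk | simp)+
  then obtain c where c: "hamiltonian_coloring F c" "int (max_color F c) = ?N"
    unfolding us(5)[symmetric] card of_nat_add add.assoc[symmetric] by blast
  have "hamiltonian_chromatic_number F \<le> max_color F c"
    unfolding hamiltonian_chromatic_number_def using c(1) by (intro Least_le) blast
  then show "int (hamiltonian_chromatic_number F) \<le> ?N" using c(2) by linarith
  obtain c' where c': "hamiltonian_coloring F c'" "max_color F c' = hamiltonian_chromatic_number F"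
    using hamiltonian_chromatic_number_attained[OF F(1)] by blast
  have "finite (pverts F)" by (simp add: pverts_firecracker)
  from max_color_ge[OF this big c'(1) detour_le level_ends]
  show "?N \<le> int (hamiltonian_chromatic_number F)" unfolding card c'(2) .
qed

end

theorem theorem7:
  fixes m k :: nat
  assumes "m \<ge> 3" and "k \<ge> 4"
  shows "real (hamiltonian_chromatic_number (firecracker m k)) =
    (if odd m
     then (real m)^2 * (real k)^2 - 6 * real m * (real k - 1) - real k / 2 * ((real m)^2 - 1) + 2
     else (real m)^2 * (real k)^2 - 6 * real m * (real k - 1) - real k / 2 * (real m)^2 + 2)"
proof -
  define h where "h = m div 2"
  define e :: nat where "e = (if odd m then 0 else 1)"
  interpret firecracker_levels h e m k
    using assms by unfold_locales (auto simp: h_def e_def)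
  have N: "real (hamiltonian_chromatic_number F) =
      (real m * real k - 1) * (real m * real k - 1 - real e) - 2 * real (sum level (pverts F)) + real (1 - e)"
    using arg_cong[OF hamiltonian_chromatic_number_eq, of real_of_int] by simp
  \<comment> \<open>Naming the product keeps its truncated subtraction out of the cast to the reals
    until the parity is known.\<close>
  define q where "q = h * (h + 1 - 2 * e)"
  have S: "real (sum level (pverts F)) = real q * real k + 2 * real m * real k - 3 * real m"
    using arg_cong[OF sum_level[folded q_def], of real] by simp
  show ?thesis
  proof (cases rule: cases_eps)
    case 1
    then have "real q = ((real m)^2 - 1) / 4"
      by (simp add: q_def power2_eq_square field_simps)
    with N S 1 show ?thesis by (simp add: power2_eq_square field_simps)
  next
    case 2
    then have "real q = ((real m)^2 - 2 * real m) / 4"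
      using h by (simp add: q_def power2_eq_square field_simps of_nat_diff)
    with N S 2 show ?thesis by (simp add: power2_eq_square field_simps)
  qed
qed

end
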